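(* Let $A$ be a finite set, let $X \subset A^{\mathbb{Z}}$ be a subshift of finite type, and let $\mathcal{C}$ denote the poset of irreducible components of $X$. Suppose that $\tau \colon X \to X$ is an endomorphism of $X$. Then the following hold: (i) there exists a unique map $\rho = \rho_\tau \colon \mathcal{C} \to \mathcal{C}$ such that, for every $C \in \mathcal{C}$, one has $\tau(C) \subset \rho(C)$; (ii) for every $x \in X$, one has $\rho(C_\alpha(x)) = C_\alpha(\tau(x))$ and $\rho(C_\omega(x)) = C_\omega(\tau(x))$; (iii) the map $\rho \colon \mathcal{C} \to \mathcal{C}$ is a poset endomorphism of $\mathcal{C}$. Moreover, the map $\mathrm{End}(X,\sigma) \to \mathrm{End}(\mathcal{C},\preceq)$, $\tau \mapsto \rho_\tau$, is a monoid morphism.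
   Context: $A^{\mathbb{Z}}$ carries the product topology ($A$ discrete) and the shift homeomorphism $\sigma$, $(\sigma(x))_i = x_{i+1}$. A subshift is a closed subset $X\subset A^{\mathbb{Z}}$ with $\sigma(X)=X$. It is of finite type if there are an integer $n\ge 0$ and $S\subset A^n$ such that $X$ is the set of all $x\in A^{\mathbb{Z}}$ with $(x_{i+1},\dots,x_{i+n})\in S$ for all $i\in\mathbb{Z}$. An endomorphism of $X$ is a continuous map $\tau\colon X\to X$ commuting with $\sigma$; $\mathrm{End}(X,\sigma)$ is the monoid (under composition) of endomorphisms of $X$. $\mathrm{NW}(X)$ is the set of $x\in X$ such that for every neighborhood $U$ of $x$ in $X$ there is $n\ge1$ with $U\cap\sigma^n(U)\neq\varnothing$. A subshift $Y$ is irreducible if it is non-empty and for all non-empty open $U,W\subset Y$ there is $n\ge 1$ with $U\cap\sigma^n(W)\ne\varnothing$. For a subshift of finite type $X$, there is a unique finite partition $\mathcal{C}$ of $\mathrm{NW}(X)$ into irreducible subshifts; its elements are the irreducible components of $X$. For $x\in X$, $\alpha(x)$ (resp. $\omega(x)$) is the set of limits of convergent sequences $(\sigma^{-n_k}(x))_k$ (resp. $(\sigma^{n_k}(x))_k$) with $(n_k)$ a strictly increasing sequence of non-negative integers; there are unique $C_\alpha(x),C_\omega(x)\in\mathcal{C}$ with $\alpha(x)\subset C_\alpha(x)$, $\omega(x)\subset C_\omega(x)$. $\mathcal{C}$ is partially ordered by: $C\preceq C'$ iff there is $x\in X$ with $C_\alpha(x)=C$ and $C_\omega(x)=C'$. $\mathrm{End}(\mathcal{C},\preceq)$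 is the monoid of order-preserving maps $\mathcal{C}\to\mathcal{C}$ (poset endomorphisms). *)

theory Defs
  imports "HOL-Analysis.Analysis" "HOL-Algebra.Group"
begin

section \<open>Subshifts\<close>

definition full_shift :: "'a set \<Rightarrow> (int \<Rightarrow> 'a) topology" where
  "full_shift A = product_topology (\<lambda>_. discrete_topology A) UNIV"

text \<open>The shift is defined on all functions of type \<^typ>\<open>int \<Rightarrow> 'a\<close>, where it is a bijection;
  hence \<open>\<sigma>\<^sup>-\<^sup>1\<close> is its inverse on the whole type.\<close>

definition shift :: "(int \<Rightarrow> 'a) \<Rightarrow> (int \<Rightarrow> 'a)" where
  "shift x = (\<lambda>i. x (i + 1))"

definition unshift :: "(int \<Rightarrow> 'a) \<Rightarrow> (int \<Rightarrow> 'a)" where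
  "unshift = inv_into UNIV shift"

definition subshift :: "'a set \<Rightarrow> (int \<Rightarrow> 'a) set \<Rightarrow> bool" where
  "subshift A X \<longleftrightarrow> closedin (full_shift A) X \<and> shift ` X = X"

definition subshift_of_finite_type :: "'a set \<Rightarrow> (int \<Rightarrow> 'a) set \<Rightarrow> bool" where
  "subshift_of_finite_type A X \<longleftrightarrow> subshift A X \<and>
     (\<exists>(n::nat) S. S \<subseteq> {w. set w \<subseteq> A \<and> length w = n} \<and>
        X = {x \<in> topspace (full_shift A). \<forall>i. map (\<lambda>k. x (i + int k)) [1..<Suc n] \<in> S})"

abbreviation sub_top :: "'a set \<Rightarrow> (int \<Rightarrow> 'a) set \<Rightarrow> (int \<Rightarrow> 'a) topology" where
  "sub_top A X \<equiv> subtopology (full_shift A) X"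

section \<open>Irreducible components\<close>

definition neighborhood :: "'b topology \<Rightarrow> 'b \<Rightarrow> 'b set \<Rightarrow> bool" where
  "neighborhood T x U \<longleftrightarrow> U \<subseteq> topspace T \<and> (\<exists>V. openin T V \<and> x \<in> V \<and> V \<subseteq> U)"

definition NW :: "'a set \<Rightarrow> (int \<Rightarrow> 'a) set \<Rightarrow> (int \<Rightarrow> 'a) set" where
  "NW A X = {x \<in> X. \<forall>U. neighborhood (sub_top A X) x U \<longrightarrow>
                        (\<exists>n\<ge>1. U \<inter> (shift ^^ n) ` U \<noteq> {})}"

definition irreducible_subshift :: "'a set \<Rightarrow> (int \<Rightarrow> 'a) set \<Rightarrow> bool" where
  "irreducible_subshift A Y \<longleftrightarrow> subshift A Y \<and> Y \<noteq> {} \<and>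
     (\<forall>U W. openin (sub_top A Y) U \<and> U \<noteq> {} \<and> openin (sub_top A Y) W \<and> W \<noteq> {} \<longrightarrow>
            (\<exists>n\<ge>1. U \<inter> (shift ^^ n) ` W \<noteq> {}))"

definition irr_components :: "'a set \<Rightarrow> (int \<Rightarrow> 'a) set \<Rightarrow> (int \<Rightarrow> 'a) set set" where
  "irr_components A X =
     (THE P. finite P \<and> partition_on (NW A X) P \<and> (\<forall>C\<in>P. irreducible_subshift A C))"

definition alpha_limit :: "'a set \<Rightarrow> (int \<Rightarrow> 'a) set \<Rightarrow> (int \<Rightarrow> 'a) \<Rightarrow> (int \<Rightarrow> 'a) set" where
  "alpha_limit A X x =
     {y. \<exists>n::nat \<Rightarrow> nat. strict_mono n \<and>
           limitin (sub_top A X) (\<lambda>k. (unshift ^^ n k) x) y sequentially}"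

definition omega_limit :: "'a set \<Rightarrow> (int \<Rightarrow> 'a) set \<Rightarrow> (int \<Rightarrow> 'a) \<Rightarrow> (int \<Rightarrow> 'a) set" where
  "omega_limit A X x =
     {y. \<exists>n::nat \<Rightarrow> nat. strict_mono n \<and>
           limitin (sub_top A X) (\<lambda>k. (shift ^^ n k) x) y sequentially}"

definition C_alpha :: "'a set \<Rightarrow> (int \<Rightarrow> 'a) set \<Rightarrow> (int \<Rightarrow> 'a) \<Rightarrow> (int \<Rightarrow> 'a) set" where
  "C_alpha A X x = (THE C. C \<in> irr_components A X \<and> alpha_limit A X x \<subseteq> C)"

definition C_omega :: "'a set \<Rightarrow> (int \<Rightarrow> 'a) set \<Rightarrow> (int \<Rightarrow> 'a) \<Rightarrow> (int \<Rightarrow> 'a) set" where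
  "C_omega A X x = (THE C. C \<in> irr_components A X \<and> omega_limit A X x \<subseteq> C)"

definition comp_le ::
    "'a set \<Rightarrow> (int \<Rightarrow> 'a) set \<Rightarrow> (int \<Rightarrow> 'a) set \<Rightarrow> (int \<Rightarrow> 'a) set \<Rightarrow> bool" where
  "comp_le A X C C' \<longleftrightarrow> (\<exists>x\<in>X. C_alpha A X x = C \<and> C_omega A X x = C')"

section \<open>Endomorphism monoids\<close>

text \<open>Maps between carriers are represented by extensional functions, so that equality of
  functions is equality of maps.\<close>

definition endomorphism :: "'a set \<Rightarrow> (int \<Rightarrow> 'a) set \<Rightarrow> ((int \<Rightarrow> 'a) \<Rightarrow> (int \<Rightarrow> 'a)) \<Rightarrow> bool" where
  "endomorphism A X \<tau> \<longleftrightarrow> \<tau> \<in> X \<rightarrow>\<^sub>E X \<and> continuous_map (sub_top A X) (sub_top A X) \<tau> \<and>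
     (\<forall>x\<in>X. \<tau> (shift x) = shift (\<tau> x))"

definition End_shift :: "'a set \<Rightarrow> (int \<Rightarrow> 'a) set \<Rightarrow> ((int \<Rightarrow> 'a) \<Rightarrow> (int \<Rightarrow> 'a)) monoid" where
  "End_shift A X =
     \<lparr>carrier = {\<tau>. endomorphism A X \<tau>}, mult = compose X, one = restrict id X\<rparr>"

definition poset_endomorphism :: "'b set \<Rightarrow> ('b \<Rightarrow> 'b \<Rightarrow> bool) \<Rightarrow> ('b \<Rightarrow> 'b) \<Rightarrow> bool" where
  "poset_endomorphism P R f \<longleftrightarrow> f \<in> P \<rightarrow>\<^sub>E P \<and> monotone_on P R R f"

definition End_poset :: "'b set \<Rightarrow> ('b \<Rightarrow> 'b \<Rightarrow> bool) \<Rightarrow> ('b \<Rightarrow> 'b) monoid" where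
  "End_poset P R =
     \<lparr>carrier = {f. poset_endomorphism P R f}, mult = compose P, one = restrict id P\<rparr>"

text \<open>The library's \<^const>\<open>hom\<close> only asks for multiplicativity.\<close>

definition monoid_morphism :: "('b, 'm) monoid_scheme \<Rightarrow> ('c, 'n) monoid_scheme \<Rightarrow> ('b \<Rightarrow> 'c) \<Rightarrow> bool" where
  "monoid_morphism M N h \<longleftrightarrow> monoid M \<and> monoid N \<and> h \<in> hom M N \<and> h \<one>\<^bsub>M\<^esub> = \<one>\<^bsub>N\<^esub>"

definition induced_map ::
    "'a set \<Rightarrow> (int \<Rightarrow> 'a) set \<Rightarrow> ((int \<Rightarrow> 'a) \<Rightarrow> (int \<Rightarrow> 'a)) \<Rightarrow> ((int \<Rightarrow> 'a) set \<Rightarrow> (int \<Rightarrow> 'a) set) \<Rightarrow> bool" where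
  "induced_map A X \<tau> \<rho> \<longleftrightarrow>
     \<rho> \<in> irr_components A X \<rightarrow>\<^sub>E irr_components A X \<and> (\<forall>C\<in>irr_components A X. \<tau> ` C \<subseteq> \<rho> C)"

definition rho ::
    "'a set \<Rightarrow> (int \<Rightarrow> 'a) set \<Rightarrow> ((int \<Rightarrow> 'a) \<Rightarrow> (int \<Rightarrow> 'a)) \<Rightarrow> ((int \<Rightarrow> 'a) set \<Rightarrow> (int \<Rightarrow> 'a) set)" where
  "rho A X \<tau> = (THE \<rho>. induced_map A X \<tau> \<rho>)"

end

theory Submission
  imports Defs
begin

text \<open>
  A continuous equivariant image of an irreducible subshift that is covered by finitely many
  subshifts lies in one of them. So the decomposition of the non-wandering set into finitely many
  irreducible subshifts is unique, and an endomorphism \<open>\<tau>\<close>, which preserves the non-wandering set,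
  maps each component into exactly one component: this is \<open>\<rho>\<close>. Limit sets consist of non-wandering
  points, and by compactness an orbit cannot accumulate at two disjoint closed invariant sets that
  together contain its limit set; so every limit set lies in one component. As \<open>\<tau>\<close> maps limit sets
  of \<open>x\<close> into limit sets of \<open>\<tau> x\<close>, it follows that \<open>\<rho>\<close> is compatible with \<open>C\<^sub>\<alpha>\<close> and \<open>C\<^sub>\<omega>\<close>,
  hence monotone.

  Finite type is only used for the existence of the decomposition. There, two points sharing an
  \<open>n\<close>-block can be glued along it, so ``block \<open>u\<close> is followed by block \<open>v\<close> in some point'' is a
  transitive relation, and the components are the sets of points all of whose blocks lie in one of
  its finitely many communicating classes.
\<close>

section \<open>Limit points of orbits\<close>

definition limit_points :: "'b topology \<Rightarrow> (nat \<Rightarrow> 'b) \<Rightarrow> 'b set" where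
  "limit_points T f = {y. \<exists>m. strict_mono m \<and> limitin T (f \<circ> m) y sequentially}"

lemma limit_points_nonempty:
  assumes "compact_space T" and "metrizable_space T" and "range f \<subseteq> topspace T"
  shows "limit_points T f \<noteq> {}"
proof -
  obtain M d where "Metric_space M d" and T: "T = Metric_space.mtopology M d"
    using \<open>metrizable_space T\<close> unfolding metrizable_space_def by blast
  interpret Metric_space M d by fact
  show ?thesis
    using assms unfolding T compact_space_sequentially limit_points_def by fastforce
qed

lemma limit_points_subsequence:
  assumes "strict_mono r"
  shows "limit_points T (f \<circ> r) \<subseteq> limit_points T f"
  unfolding limit_points_def comp_assoc using strict_mono_o[OF assms] by blast

lemma limit_points_visits_nhd:
  assumes "y \<in> limit_points T f" and "openin T U" and "y \<in> U"
  obtains k where "k \<ge> K" "f k \<in> U"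
proof -
  obtain m where "strict_mono m" and lim: "limitin T (f \<circ> m) y sequentially"
    using assms(1) unfolding limit_points_def by blast
  have "\<forall>\<^sub>F k in sequentially. (f \<circ> m) k \<in> U"
    using lim assms(2,3) unfolding limitin_def by blast
  then obtain k where "k \<ge> K" "f (m k) \<in> U"
    unfolding eventually_sequentially by (metis comp_apply nat_le_linear)
  moreover have "k \<le> m k"
    using \<open>strict_mono m\<close> by (rule seq_suble)
  ultimately show thesis
    using that by (meson order_trans)
qed

lemma eventually_in_nhd_of_limit_points:
  assumes "compact_space T" and "metrizable_space T" and range: "range f \<subseteq> topspace T"
    and U: "openin T U" "limit_points T f \<subseteq> U"
  shows "\<forall>\<^sub>F k in sequentially. f k \<in> U"
proof (rule ccontr)
  assume "\<not> ?thesis"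
  then have "infinite {k. f k \<notin> U}"
    by (simp add: eventually_cofinite flip: cofinite_eq_sequentially)
  then obtain r :: "nat \<Rightarrow> nat" where r: "strict_mono r" "\<And>k. f (r k) \<notin> U"
    using infinite_enumerate by blast
  have "limit_points T (f \<circ> r) \<noteq> {}"
    using range by (intro limit_points_nonempty assms(1,2)) auto
  then obtain y where y: "y \<in> limit_points T (f \<circ> r)" by blast
  then have "y \<in> U"
    using limit_points_subsequence[OF r(1), of T f] U(2) by auto
  then show False
    using limit_points_visits_nhd[OF y U(1)] r(2) by (metis comp_apply)
qed

lemma continuous_map_limit_points:
  assumes "continuous_map T T' g" and "y \<in> limit_points T f"
  shows "g y \<in> limit_points T' (g \<circ> f)"
  using assms continuous_map_limit[OF assms(1)] unfolding limit_points_def comp_assoc by blast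

lemma orbit_trapped:
  assumes orbit: "\<And>k. f (Suc k) = \<phi> (f k)" and "disjnt U V"
    and near: "\<And>k. k \<ge> K \<Longrightarrow> f k \<in> U \<inter> \<phi> -` U \<union> V \<inter> \<phi> -` V"
    and "f K \<in> U" and "k \<ge> K"
  shows "f k \<in> U"
  using \<open>k \<ge> K\<close>
proof (induction k rule: dec_induct)
  case (step k)
  then have "f k \<in> \<phi> -` U" using near[of k] \<open>disjnt U V\<close> by (auto simp: disjnt_iff)
  then show ?case using orbit by simp
qed (fact \<open>f K \<in> U\<close>)

text \<open>A continuous map does not send points close to \<open>D\<close> to points close to \<open>E\<close>, so an orbit
  that stays close to \<open>D \<union> E\<close> never leaves the vicinity of \<open>D\<close> again.\<close>

lemma orbit_limit_points_subset:
  assumes T: "compact_space T" "metrizable_space T"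
    and \<phi>: "continuous_map T T \<phi>"
    and orbit: "range f \<subseteq> topspace T" "\<And>k. f (Suc k) = \<phi> (f k)"
    and closed: "closedin T D" "closedin T E" and "disjnt D E"
    and invariant: "\<phi> ` D \<subseteq> D" "\<phi> ` E \<subseteq> E"
    and limits: "limit_points T f \<subseteq> D \<union> E" "limit_points T f \<inter> D \<noteq> {}"
  shows "limit_points T f \<subseteq> D"
proof
  obtain U V where U: "openin T U" "D \<subseteq> U" and V: "openin T V" "E \<subseteq> V" and UV: "disjnt U V"
    using metrizable_imp_normal_space[OF T(2)] closed \<open>disjnt D E\<close>
    unfolding normal_space_def by meson
  have "\<forall>\<^sub>F k in sequentially.
      f k \<in> U \<inter> {x \<in> topspace T. \<phi> x \<in> U} \<union> V \<inter> {x \<in> topspace T. \<phi> x \<in> V}"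
  proof (intro eventually_in_nhd_of_limit_points[OF T orbit(1)] openin_Un openin_Int
        openin_continuous_map_preimage[OF \<phi>] U(1) V(1))
    show "limit_points T f \<subseteq>
        U \<inter> {x \<in> topspace T. \<phi> x \<in> U} \<union> V \<inter> {x \<in> topspace T. \<phi> x \<in> V}"
      using limits(1) U(2) V(2) invariant closed[THEN closedin_subset] by blast
  qed
  then obtain K where near: "\<And>k. k \<ge> K \<Longrightarrow> f k \<in> U \<inter> \<phi> -` U \<union> V \<inter> \<phi> -` V"
    unfolding eventually_sequentially by blast
  from limits(2) U(2) obtain y where y: "y \<in> limit_points T f" "y \<in> U" by blast
  obtain K' where K': "K' \<ge> K" "f K' \<in> U"
    using limit_points_visits_nhd[OF y(1) U(1) y(2)] .
  have trapped: "f k \<in> U" if "k \<ge> K'" for k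
    by (rule orbit_trapped[OF orbit(2) UV near[OF order_trans[OF K'(1)]] K'(2) that])
  fix z assume z: "z \<in> limit_points T f"
  have "z \<notin> V"
  proof
    assume "z \<in> V"
    with z V(1) obtain k where "k \<ge> K'" "f k \<in> V" by (rule limit_points_visits_nhd)
    then show False using trapped UV by (auto simp: disjnt_iff)
  qed
  then show "z \<in> D" using z limits(1) V(2) by blast
qed

section \<open>The topology of the full shift\<close>

definition agree :: "nat \<Rightarrow> (int \<Rightarrow> 'a) \<Rightarrow> (int \<Rightarrow> 'a) \<Rightarrow> bool" where
  "agree N x y \<longleftrightarrow> (\<forall>i\<in>{- int N..int N}. x i = y i)"

lemma agree_refl [simp]: "agree N x x"
  by (simp add: agree_def)

lemma agree_trans [trans]: "agree N x y \<Longrightarrow> agree N y z \<Longrightarrow> agree N x z"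
  by (simp add: agree_def)

lemma agree_mono: "agree N x y \<Longrightarrow> M \<le> N \<Longrightarrow> agree M x y"
  by (auto simp: agree_def)

lemma mem_topspace_full_shift: "x \<in> topspace (full_shift A) \<longleftrightarrow> (\<forall>i. x i \<in> A)"
  by (auto simp: full_shift_def PiE_def extensional_def)

lemma compact_space_full_shift: "finite A \<Longrightarrow> compact_space (full_shift A)"
  by (simp add: full_shift_def compact_space_product_topology compact_space_discrete_topology)

lemma metrizable_space_full_shift: "metrizable_space (full_shift A)"
  by (simp add: full_shift_def metrizable_space_product_topology
      metrizable_space_discrete_topology)

lemma openin_agree: "openin (full_shift A) {y \<in> topspace (full_shift A). agree N x y}"
proof -
  have "openin (full_shift A) {y \<in> topspace (full_shift A). y i \<in> A \<inter> {x i}}" for i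
    unfolding full_shift_def
    by (rule openin_continuous_map_preimage[OF continuous_map_product_projection]) auto
  then have "openin (full_shift A)
      ((\<Inter>i\<in>{- int N..int N}. {y \<in> topspace (full_shift A). y i \<in> A \<inter> {x i}})
        \<inter> topspace (full_shift A))"
    by (intro openin_INT) auto
  also have "(\<Inter>i\<in>{- int N..int N}. {y \<in> topspace (full_shift A). y i \<in> A \<inter> {x i}})
      \<inter> topspace (full_shift A) = {y \<in> topspace (full_shift A). agree N x y}"
    by (auto simp: agree_def mem_topspace_full_shift)
  finally show ?thesis .
qed

lemma openin_full_shift_agree:
  assumes "openin (full_shift A) U" and "x \<in> U"
  obtains N where "\<And>y. y \<in> topspace (full_shift A) \<Longrightarrow> agree N x y \<Longrightarrow> y \<in> U"
proof -
  obtain W where finite: "finite {i. W i \<noteq> A}" and x: "x \<in> Pi\<^sub>E UNIV W" and U: "Pi\<^sub>E UNIV W \<subseteq> U"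
    using assms unfolding full_shift_def openin_product_topology_alt by auto
  from finite obtain N :: nat where N: "(\<lambda>i. nat \<bar>i\<bar>) ` {i. W i \<noteq> A} \<subseteq> {..N}"
    using finite_nat_iff_bounded_le by blast
  have "y \<in> U" if y: "y \<in> topspace (full_shift A)" "agree N x y" for y
  proof -
    have "y i \<in> W i" for i
    proof (cases "W i = A")
      case True
      then show ?thesis using y(1) by (simp add: mem_topspace_full_shift)
    next
      case False
      then have "\<bar>i\<bar> \<le> int N" using N by auto
      then have "y i = x i" using y(2) by (simp add: agree_def abs_le_iff)
      then show ?thesis using x by auto
    qed
    then show ?thesis using U by auto
  qed
  then show thesis by (rule that)
qed

lemma openin_sub_top_iff:
  assumes "X \<subseteq> topspace (full_shift A)"
  shows "openin (sub_top A X) U \<longleftrightarrow> U \<subseteq> X \<and> (\<forall>x\<in>U. \<exists>N. \<forall>y\<in>X. agree N x y \<longrightarrow> y \<in> U)"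
proof (intro iffI conjI ballI)
  assume U: "openin (sub_top A X) U"
  then show "U \<subseteq> X" using openin_subset by fastforce
  obtain T where T: "openin (full_shift A) T" "U = T \<inter> X"
    using U by (auto simp: openin_subtopology)
  fix x assume "x \<in> U"
  then obtain N where "\<And>y. y \<in> topspace (full_shift A) \<Longrightarrow> agree N x y \<Longrightarrow> y \<in> T"
    using openin_full_shift_agree[OF T(1)] T(2) by blast
  then show "\<exists>N. \<forall>y\<in>X. agree N x y \<longrightarrow> y \<in> U" using T(2) assms by blast
next
  assume U: "U \<subseteq> X \<and> (\<forall>x\<in>U. \<exists>N. \<forall>y\<in>X. agree N x y \<longrightarrow> y \<in> U)"
  have "\<exists>V. openin (sub_top A X) V \<and> x \<in> V \<and> V \<subseteq> U" if "x \<in> U" for x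
  proof -
    from U that obtain N where N: "\<forall>y\<in>X. agree N x y \<longrightarrow> y \<in> U" by blast
    let ?V = "X \<inter> {y \<in> topspace (full_shift A). agree N x y}"
    have "openin (sub_top A X) ?V" by (rule openin_subtopology_Int2[OF openin_agree])
    moreover have "x \<in> ?V" using U that assms by auto
    moreover have "?V \<subseteq> U" using N by blast
    ultimately show ?thesis by blast
  qed
  then show "openin (sub_top A X) U" by (subst openin_subopen) blast
qed

lemma openin_sub_top_agree:
  assumes "X \<subseteq> topspace (full_shift A)"
  shows "openin (sub_top A X) {y \<in> X. agree N x y}"
  unfolding openin_sub_top_iff[OF assms] using agree_trans by blast

lemma closedin_full_shift_iff:
  "closedin (full_shift A) Y \<longleftrightarrow> Y \<subseteq> topspace (full_shift A) \<and>
     (\<forall>x\<in>topspace (full_shift A). (\<forall>N. \<exists>y\<in>Y. agree N x y) \<longrightarrow> x \<in> Y)"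
  using openin_sub_top_iff[of "topspace (full_shift A)" A "topspace (full_shift A) - Y"]
  unfolding closedin_def subtopology_topspace by blast

section \<open>Subshifts\<close>

definition translate :: "int \<Rightarrow> (int \<Rightarrow> 'a) \<Rightarrow> (int \<Rightarrow> 'a)" where
  "translate p x = (\<lambda>i. x (i + p))"

lemma translate_translate [simp]: "translate p (translate q x) = translate (p + q) x"
  by (simp add: translate_def add.assoc)

lemma translate_0 [simp]: "translate 0 x = x"
  by (simp add: translate_def)

lemma shift_eq_translate: "shift = translate 1"
  by (simp add: fun_eq_iff shift_def translate_def)

lemma unshift_eq_translate: "unshift = translate (-1)"
proof -
  have "inj (shift :: (int \<Rightarrow> 'a) \<Rightarrow> _)"
    by (rule inj_on_inverseI[where g = "translate (-1)"]) (simp add: shift_eq_translate)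
  then have "unshift x = translate (-1) x" for x :: "int \<Rightarrow> 'a"
    unfolding unshift_def by (rule inv_f_eq) (simp add: shift_eq_translate)
  then show ?thesis by blast
qed

lemma shift_power: "(shift ^^ n) x = translate (int n) x"
  by (induction n) (simp_all add: shift_eq_translate)

lemma unshift_power: "(unshift ^^ n) x = translate (- int n) x"
  by (induction n) (simp_all add: unshift_eq_translate)

lemma Int_shift_power_image_nonempty:
  "U \<inter> (shift ^^ m) ` W \<noteq> {} \<longleftrightarrow> (\<exists>z\<in>W. translate (int m) z \<in> U)"
  by (auto simp: shift_power)

lemma subshiftI:
  assumes "closedin (full_shift A) Y" and translate: "\<And>p x. x \<in> Y \<Longrightarrow> translate p x \<in> Y"
  shows "subshift A Y"
proof -
  have "x \<in> shift ` Y" if "x \<in> Y" for x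
    using translate[OF that, of "-1"]
    by (rule rev_image_eqI) (simp add: shift_eq_translate)
  then have "shift ` Y = Y" using translate by (auto simp: shift_eq_translate)
  then show ?thesis using assms(1) by (simp add: subshift_def)
qed

locale subshift_system =
  fixes A :: "'a set" and X :: "(int \<Rightarrow> 'a) set"
  assumes subshift: "subshift A X"
begin

lemma subset_full_shift: "X \<subseteq> topspace (full_shift A)"
  using subshift by (auto simp: subshift_def dest: closedin_subset)

lemma topspace_full_shift_Int [simp]: "topspace (full_shift A) \<inter> X = X"
  using subset_full_shift by (simp add: Int_absorb1)

lemma topspace_sub_top: "topspace (sub_top A X) = X"
  by simp

lemma translate_closed:
  assumes "x \<in> X"
  shows "translate p x \<in> X"
proof (induction p rule: int_induct[where k = 0])
  case base
  show ?case using assms by simp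
next
  case (step1 p)
  then have "shift (translate p x) \<in> X" using subshift by (auto simp: subshift_def)
  then show ?case by (simp add: shift_eq_translate add.commute)
next
  case (step2 p)
  then obtain y where "y \<in> X" "translate p x = shift y"
    using subshift by (auto simp: subshift_def)
  then have "translate (-1) (translate p x) \<in> X" by (simp add: shift_eq_translate)
  then show ?case by simp
qed

lemma translate_mem_iff [simp]: "translate p x \<in> X \<longleftrightarrow> x \<in> X"
  using translate_closed[of x p] translate_closed[of "translate p x" "- p"] by auto

end

section \<open>Non-wandering points and irreducibility\<close>

lemma mem_NW_iff:
  "x \<in> NW A X \<longleftrightarrow> x \<in> X \<and>
     (\<forall>U. openin (sub_top A X) U \<and> x \<in> U \<longrightarrow> (\<exists>m\<ge>1. \<exists>z\<in>U. translate (int m) z \<in> U))"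
proof -
  have "(\<forall>U. neighborhood (sub_top A X) x U \<longrightarrow> (\<exists>m\<ge>1. \<exists>z\<in>U. translate (int m) z \<in> U)) \<longleftrightarrow>
    (\<forall>U. openin (sub_top A X) U \<and> x \<in> U \<longrightarrow> (\<exists>m\<ge>1. \<exists>z\<in>U. translate (int m) z \<in> U))"
    unfolding neighborhood_def by (meson openin_subset order_refl subsetD)
  then show ?thesis by (simp add: NW_def Int_shift_power_image_nonempty)
qed

lemma NW_subset: "NW A X \<subseteq> X"
  by (auto simp: NW_def)

lemma (in subshift_system) mem_NW_iff_agree:
  "x \<in> NW A X \<longleftrightarrow> x \<in> X \<and>
     (\<forall>N. \<exists>m\<ge>1. \<exists>z\<in>X. agree N x z \<and> agree N x (translate (int m) z))"
proof (intro iffI conjI allI)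
  assume x: "x \<in> NW A X"
  then show "x \<in> X" using NW_subset by blast
  fix N
  have "openin (sub_top A X) {z \<in> X. agree N x z}" "x \<in> {z \<in> X. agree N x z}"
    using openin_sub_top_agree[OF subset_full_shift] \<open>x \<in> X\<close> by auto
  then show "\<exists>m\<ge>1. \<exists>z\<in>X. agree N x z \<and> agree N x (translate (int m) z)"
    using x unfolding mem_NW_iff by blast
next
  assume x: "x \<in> X \<and> (\<forall>N. \<exists>m\<ge>1. \<exists>z\<in>X. agree N x z \<and> agree N x (translate (int m) z))"
  have "\<exists>m\<ge>1. \<exists>z\<in>U. translate (int m) z \<in> U" if U: "openin (sub_top A X) U" "x \<in> U" for U
  proof -
    obtain N where "\<And>y. y \<in> X \<Longrightarrow> agree N x y \<Longrightarrow> y \<in> U"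
      using U unfolding openin_sub_top_iff[OF subset_full_shift] by blast
    then show ?thesis using x translate_closed by meson
  qed
  then show "x \<in> NW A X" using x by (simp add: mem_NW_iff)
qed

lemma irreducible_subshiftI:
  assumes Y: "subshift A Y" "Y \<noteq> {}"
    and connect: "\<And>x y N. x \<in> Y \<Longrightarrow> y \<in> Y \<Longrightarrow>
      \<exists>m\<ge>1. \<exists>z\<in>Y. agree N y z \<and> agree N x (translate (int m) z)"
  shows "irreducible_subshift A Y"
proof -
  interpret subshift_system A Y by unfold_locales (fact Y(1))
  have "\<exists>m\<ge>1. U \<inter> (shift ^^ m) ` W \<noteq> {}"
    if U: "openin (sub_top A Y) U" "U \<noteq> {}" and W: "openin (sub_top A Y) W" "W \<noteq> {}" for U W
  proof -
    note open_iff = openin_sub_top_iff[OF subset_full_shift]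
    obtain x M where x: "x \<in> Y" "\<And>z. z \<in> Y \<Longrightarrow> agree M x z \<Longrightarrow> z \<in> U"
      using U unfolding open_iff by blast
    obtain y N where y: "y \<in> Y" "\<And>z. z \<in> Y \<Longrightarrow> agree N y z \<Longrightarrow> z \<in> W"
      using W unfolding open_iff by blast
    obtain m z where "m \<ge> 1" and z: "z \<in> Y" "agree (max M N) y z"
      "agree (max M N) x (translate (int m) z)"
      using connect[OF x(1) y(1)] by blast
    have "translate (int m) z \<in> U"
      using z(1) agree_mono[OF z(3), of M] by (intro x(2)) simp_all
    moreover have "z \<in> W"
      using z(1) agree_mono[OF z(2), of N] by (intro y(2)) simp_all
    ultimately show ?thesis
      unfolding Int_shift_power_image_nonempty using \<open>m \<ge> 1\<close> by blast
  qed
  then show ?thesis using Y by (simp add: irreducible_subshift_def)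
qed

lemma irreducible_subshiftD:
  assumes "irreducible_subshift A Y"
  shows "subshift A Y" and "Y \<noteq> {}"
  using assms by (auto simp: irreducible_subshift_def)

lemma irreducible_subshift_visits:
  assumes "irreducible_subshift A Y"
    and "openin (sub_top A Y) U" "U \<noteq> {}" and "openin (sub_top A Y) W" "W \<noteq> {}"
  obtains m z where "z \<in> W" "translate (int m) z \<in> U"
  using assms unfolding irreducible_subshift_def Int_shift_power_image_nonempty by meson

lemma irreducible_mem_finite_cover:
  assumes Y: "irreducible_subshift A Y"
    and \<D>: "finite \<D>" "\<Union>\<D> = Y"
    and closed: "\<And>D. D \<in> \<D> \<Longrightarrow> closedin (sub_top A Y) D"
    and invariant: "\<And>D p x. D \<in> \<D> \<Longrightarrow> x \<in> D \<Longrightarrow> translate p x \<in> D"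
  shows "Y \<in> \<D>"
proof -
  interpret subshift_system A Y by unfold_locales (rule irreducible_subshiftD[OF Y])
  have open_Diff: "openin (sub_top A Y) (Y - D)" if "closedin (sub_top A Y) D" for D
    using that by (simp add: closedin_def)
  have "Y \<in> \<E>" if "\<E> \<subseteq> \<D>" "Y \<subseteq> \<Union>\<E>" for \<E>
    using finite_subset[OF that(1) \<D>(1)] that
  proof (induction \<E> rule: finite_induct)
    case empty
    then show ?case using irreducible_subshiftD(2)[OF Y] by simp
  next
    case (insert D \<E>)
    have "D \<in> \<D>" "\<E> \<subseteq> \<D>" using insert.prems(1) by auto
    note D = closed[OF \<open>D \<in> \<D>\<close>] invariant[OF \<open>D \<in> \<D>\<close>]
    have \<E>: "closedin (sub_top A Y) (\<Union>\<E>)"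
      by (rule closedin_Union[OF insert.hyps(1)], rule closed) (use \<open>\<E> \<subseteq> \<D>\<close> in blast)
    have "Y - D = {} \<or> Y - \<Union>\<E> = {}"
    proof (rule ccontr)
      assume "\<not> ?thesis"
      then have "Y - D \<noteq> {}" "Y - \<Union>\<E> \<noteq> {}" by auto
      then obtain m z where z: "z \<in> Y - \<Union>\<E>" "translate (int m) z \<in> Y - D"
        by (rule irreducible_subshift_visits[OF Y open_Diff[OF D(1)] _ open_Diff[OF \<E>]])
      then have "z \<in> D" using insert.prems(2) by blast
      then show False using D(2) z(2) by blast
    qed
    then show ?case
      using insert.IH[OF \<open>\<E> \<subseteq> \<D>\<close>] closedin_subset[OF D(1)] topspace_full_shift_Int by auto
  qed
  then show ?thesis using \<D>(2) by blast
qed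

lemma irreducible_image_subset_of_finite_cover:
  assumes Y: "irreducible_subshift A Y"
    and f: "continuous_map (sub_top A Y) (full_shift A) f"
    and commute: "\<And>p x. x \<in> Y \<Longrightarrow> f (translate p x) = translate p (f x)"
    and P: "finite P" "\<And>D. D \<in> P \<Longrightarrow> subshift A D"
    and cover: "f ` Y \<subseteq> \<Union>P"
  shows "\<exists>D\<in>P. f ` Y \<subseteq> D"
proof -
  interpret Y: subshift_system A Y by unfold_locales (rule irreducible_subshiftD[OF Y])
  have "Y \<in> (\<lambda>D. {x \<in> Y. f x \<in> D}) ` P"
  proof (rule irreducible_mem_finite_cover[OF Y])
    show "finite ((\<lambda>D. {x \<in> Y. f x \<in> D}) ` P)" using P(1) by simp
    show "\<Union>((\<lambda>D. {x \<in> Y. f x \<in> D}) ` P) = Y" using cover by auto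
    fix E assume "E \<in> (\<lambda>D. {x \<in> Y. f x \<in> D}) ` P"
    then obtain D where D: "D \<in> P" "E = {x \<in> Y. f x \<in> D}" by blast
    interpret D: subshift_system A D by unfold_locales (rule P(2)[OF D(1)])
    have "closedin (full_shift A) D" using D.subshift by (simp add: subshift_def)
    from closedin_continuous_map_preimage[OF f this]
    show "closedin (sub_top A Y) E" unfolding D(2) Y.topspace_sub_top .
    show "translate p x \<in> E" if "x \<in> E" for p x
      using that commute by (simp add: D(2))
  qed
  then show ?thesis by blast
qed

section \<open>Decompositions into irreducible subshifts\<close>

definition irreducible_decomposition ::
    "'a set \<Rightarrow> (int \<Rightarrow> 'a) set \<Rightarrow> (int \<Rightarrow> 'a) set set \<Rightarrow> bool" where
  "irreducible_decomposition A S P \<longleftrightarrow>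
     finite P \<and> partition_on S P \<and> (\<forall>C\<in>P. irreducible_subshift A C)"

lemma irreducible_decompositionD:
  assumes "irreducible_decomposition A S P"
  shows "finite P" and "\<Union>P = S" and "\<And>C. C \<in> P \<Longrightarrow> irreducible_subshift A C"
    and "\<And>C D x. C \<in> P \<Longrightarrow> D \<in> P \<Longrightarrow> x \<in> C \<Longrightarrow> x \<in> D \<Longrightarrow> C = D"
  using assms unfolding irreducible_decomposition_def partition_on_def
  by (simp_all, meson disjointD disjoint_iff)

lemma irreducible_subset_of_decomposition:
  assumes P: "irreducible_decomposition A S P" and Y: "irreducible_subshift A Y" and "Y \<subseteq> S"
  shows "\<exists>D\<in>P. Y \<subseteq> D"
proof -
  have "\<exists>D\<in>P. id ` Y \<subseteq> D"
  proof (rule irreducible_image_subset_of_finite_cover[OF Y])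
    show "continuous_map (sub_top A Y) (full_shift A) id"
      by (rule continuous_map_from_subtopology[OF continuous_map_id])
    show "subshift A D" if "D \<in> P" for D
      by (rule irreducible_subshiftD(1)[OF irreducible_decompositionD(3)[OF P that]])
  qed (use irreducible_decompositionD(1,2)[OF P] \<open>Y \<subseteq> S\<close> in auto)
  then show ?thesis by simp
qed

lemma irreducible_decomposition_subset:
  assumes P: "irreducible_decomposition A S P" and Q: "irreducible_decomposition A S Q"
  shows "P \<subseteq> Q"
proof
  note P_props = irreducible_decompositionD[OF P] and Q_props = irreducible_decompositionD[OF Q]
  fix C assume C: "C \<in> P"
  obtain D where D: "D \<in> Q" "C \<subseteq> D"
    using irreducible_subset_of_decomposition[OF Q P_props(3)[OF C]] C P_props(2) by blast
  obtain C' where C': "C' \<in> P" "D \<subseteq> C'"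
    using irreducible_subset_of_decomposition[OF P Q_props(3)[OF D(1)]] D(1) Q_props(2) by blast
  obtain x where "x \<in> C" using irreducible_subshiftD(2)[OF P_props(3)[OF C]] by blast
  then have "C = C'" using P_props(4)[OF C C'(1)] D(2) C'(2) by blast
  then show "C \<in> Q" using C'(2) D by auto
qed

lemma irr_components_eqI:
  assumes "irreducible_decomposition A (NW A X) P"
  shows "irr_components A X = P"
  unfolding irr_components_def irreducible_decomposition_def[symmetric]
proof (rule the_equality)
  show "irreducible_decomposition A (NW A X) P" by (fact assms)
  show "Q = P" if "irreducible_decomposition A (NW A X) Q" for Q
    using irreducible_decomposition_subset[OF assms that]
      irreducible_decomposition_subset[OF that assms] by blast
qed

section \<open>Endomorphisms and limit sets\<close>

context subshift_system
begin

lemma continuous_map_translate: "continuous_map (sub_top A X) (sub_top A X) (translate p)"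
proof -
  have "continuous_map (full_shift A) (full_shift A) (translate p)"
    unfolding full_shift_def translate_def continuous_map_componentwise_UNIV
    by (intro allI continuous_map_product_projection) simp
  then show ?thesis
    by (intro continuous_map_into_subtopology continuous_map_from_subtopology) auto
qed

lemma endomorphism_mem: "endomorphism A X \<tau> \<Longrightarrow> x \<in> X \<Longrightarrow> \<tau> x \<in> X"
  by (auto simp: endomorphism_def)

lemma endomorphism_continuous: "endomorphism A X \<tau> \<Longrightarrow> continuous_map (sub_top A X) (sub_top A X) \<tau>"
  by (simp add: endomorphism_def)

lemma endomorphism_translate:
  assumes \<tau>: "endomorphism A X \<tau>" and x: "x \<in> X"
  shows "\<tau> (translate p x) = translate p (\<tau> x)"
proof (induction p rule: int_induct[where k = 0])
  case (step1 p)
  have "\<tau> (shift (translate p x)) = shift (\<tau> (translate p x))"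
    using \<tau> x by (simp add: endomorphism_def)
  then show ?case using step1 by (simp add: shift_eq_translate add.commute)
next
  case (step2 p)
  have "\<tau> (shift (translate (p - 1) x)) = shift (\<tau> (translate (p - 1) x))"
    using \<tau> x by (simp add: endomorphism_def)
  then have "translate 1 (\<tau> (translate (p - 1) x)) = translate p (\<tau> x)"
    using step2 by (simp add: shift_eq_translate)
  then have "translate (-1) (translate 1 (\<tau> (translate (p - 1) x))) = translate (p - 1) (\<tau> x)"
    by simp
  then show ?case by simp
qed simp

lemma endomorphism_NW:
  assumes \<tau>: "endomorphism A X \<tau>" and x: "x \<in> NW A X"
  shows "\<tau> x \<in> NW A X"
proof -
  have "x \<in> X" using x NW_subset by blast
  have "\<exists>m\<ge>1. \<exists>z\<in>U. translate (int m) z \<in> U" if U: "openin (sub_top A X) U" "\<tau> x \<in> U" for U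
  proof -
    have "openin (sub_top A X) {z \<in> X. \<tau> z \<in> U}"
      using openin_continuous_map_preimage[OF endomorphism_continuous[OF \<tau>] U(1)]
      unfolding topspace_sub_top .
    then obtain m z where "m \<ge> 1" "z \<in> X" "\<tau> z \<in> U" "\<tau> (translate (int m) z) \<in> U"
      using x U(2) \<open>x \<in> X\<close> unfolding mem_NW_iff by blast
    then show ?thesis using endomorphism_translate[OF \<tau>] by metis
  qed
  then show ?thesis using endomorphism_mem[OF \<tau> \<open>x \<in> X\<close>] by (simp add: mem_NW_iff)
qed

lemma endomorphism_compose:
  assumes \<tau>: "endomorphism A X \<tau>" and \<tau>': "endomorphism A X \<tau>'"
  shows "endomorphism A X (compose X \<tau> \<tau>')"
  unfolding endomorphism_def
proof (intro conjI ballI)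
  show "compose X \<tau> \<tau>' \<in> X \<rightarrow>\<^sub>E X"
    using \<tau> \<tau>' by (auto simp: compose_def endomorphism_mem)
  have "continuous_map (sub_top A X) (sub_top A X) (\<tau> \<circ> \<tau>')"
    using endomorphism_continuous[OF \<tau>'] endomorphism_continuous[OF \<tau>]
    by (rule continuous_map_compose)
  then show "continuous_map (sub_top A X) (sub_top A X) (compose X \<tau> \<tau>')"
    by (rule continuous_map_eq) (simp add: compose_def)
  show "compose X \<tau> \<tau>' (shift x) = shift (compose X \<tau> \<tau>' x)" if "x \<in> X" for x
    using that \<tau> \<tau>'
    by (simp add: shift_eq_translate compose_def endomorphism_translate endomorphism_mem)
qed

lemma endomorphism_id: "endomorphism A X (restrict id X)"
  unfolding endomorphism_def
proof (intro conjI ballI)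
  show "continuous_map (sub_top A X) (sub_top A X) (restrict id X)"
    by (rule continuous_map_eq[OF continuous_map_id]) simp
  show "restrict id X (shift x) = shift (restrict id X x)" if "x \<in> X" for x
    using that by (simp add: shift_eq_translate)
qed auto

definition limit_set :: "int \<Rightarrow> (int \<Rightarrow> 'a) \<Rightarrow> (int \<Rightarrow> 'a) set" where
  "limit_set s x = limit_points (sub_top A X) (\<lambda>k. translate (s * int k) x)"

lemma omega_limit_eq: "omega_limit A X x = limit_set 1 x"
  by (simp add: omega_limit_def limit_set_def limit_points_def shift_power comp_def)

lemma alpha_limit_eq: "alpha_limit A X x = limit_set (-1) x"
  by (simp add: alpha_limit_def limit_set_def limit_points_def unshift_power comp_def)

lemma endomorphism_limit_set:
  assumes \<tau>: "endomorphism A X \<tau>" and x: "x \<in> X" and "y \<in> limit_set s x"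
  shows "\<tau> y \<in> limit_set s (\<tau> x)"
  using continuous_map_limit_points[OF endomorphism_continuous[OF \<tau>]] assms(3)
  by (fastforce simp: limit_set_def comp_def endomorphism_translate[OF \<tau> x])

lemma limit_set_subset_NW:
  assumes "s \<noteq> 0"
  shows "limit_set s x \<subseteq> NW A X"
proof
  fix y assume y: "y \<in> limit_set s x"
  then have "y \<in> X"
    using limitin_topspace unfolding limit_set_def limit_points_def by fastforce
  have "\<exists>m\<ge>1. \<exists>z\<in>U. translate (int m) z \<in> U" if U: "openin (sub_top A X) U" "y \<in> U" for U
  proof -
    note visits = limit_points_visits_nhd[OF y[unfolded limit_set_def] U]
    obtain k where k: "translate (s * int k) x \<in> U" using visits .
    obtain l where l: "l \<ge> Suc k" "translate (s * int l) x \<in> U" using visits .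
    define m where "m = nat \<bar>s\<bar> * (l - k)"
    have "m \<ge> 1" using \<open>s \<noteq> 0\<close> l(1) by (simp add: m_def Suc_le_eq)
    moreover have "int m = \<bar>s\<bar> * (int l - int k)" using l(1) by (simp add: m_def of_nat_diff)
    then have "s * int l = int m + s * int k \<or> s * int k = int m + s * int l"
      by (cases "s \<ge> 0") (auto simp: algebra_simps)
    then have "\<exists>z\<in>U. translate (int m) z \<in> U"
      using k l(2) by (metis translate_translate)
    ultimately show ?thesis by blast
  qed
  then show "y \<in> NW A X" using \<open>y \<in> X\<close> by (simp add: mem_NW_iff)
qed

end

section \<open>The induced map on irreducible components\<close>

locale decomposable_subshift = subshift_system +
  assumes finite_alphabet: "finite A"
    and decomposable: "\<exists>P. irreducible_decomposition A (NW A X) P"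
begin

lemma irreducible_decomposition_irr_components:
  "irreducible_decomposition A (NW A X) (irr_components A X)"
  using decomposable irr_components_eqI by metis

lemmas finite_irr_components =
    irreducible_decompositionD(1)[OF irreducible_decomposition_irr_components]
  and Union_irr_components =
    irreducible_decompositionD(2)[OF irreducible_decomposition_irr_components]
  and irreducible_irr_component =
    irreducible_decompositionD(3)[OF irreducible_decomposition_irr_components]
  and irr_component_unique =
    irreducible_decompositionD(4)[OF irreducible_decomposition_irr_components]

lemma irr_component_subset: "C \<in> irr_components A X \<Longrightarrow> C \<subseteq> X"
  using Union_irr_components NW_subset by blast

lemma irr_component_nonempty: "C \<in> irr_components A X \<Longrightarrow> C \<noteq> {}"
  by (rule irreducible_subshiftD(2)[OF irreducible_irr_component])

lemma subshift_irr_component: "C \<in> irr_components A X \<Longrightarrow> subshift A C"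
  by (rule irreducible_subshiftD(1)[OF irreducible_irr_component])

lemma closedin_irr_component: "C \<in> irr_components A X \<Longrightarrow> closedin (sub_top A X) C"
  using subshift_irr_component irr_component_subset
  by (simp add: subshift_def closedin_closed_subtopology closedin_subset_topspace)

lemma irr_component_translate: "C \<in> irr_components A X \<Longrightarrow> x \<in> C \<Longrightarrow> translate p x \<in> C"
  using subshift_system.translate_closed[OF subshift_system.intro[OF subshift_irr_component]] .

lemma compact_space_sub_top: "compact_space (sub_top A X)"
  using subshift compact_space_full_shift[OF finite_alphabet]
  by (intro compact_space_subtopology closedin_compact_space) (auto simp: subshift_def)

lemma metrizable_space_sub_top: "metrizable_space (sub_top A X)"
  by (intro metrizable_space_subtopology metrizable_space_full_shift)

lemma limit_set_nonempty: "x \<in> X \<Longrightarrow> limit_set s x \<noteq> {}"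
  unfolding limit_set_def
  by (intro limit_points_nonempty compact_space_sub_top metrizable_space_sub_top) auto

lemma limit_set_subset_irr_component:
  assumes x: "x \<in> X" and "s \<noteq> 0"
  shows "\<exists>C\<in>irr_components A X. limit_set s x \<subseteq> C"
proof -
  have NW: "limit_set s x \<subseteq> \<Union>(irr_components A X)"
    unfolding Union_irr_components by (rule limit_set_subset_NW[OF \<open>s \<noteq> 0\<close>])
  then obtain y C where y: "y \<in> limit_set s x" "y \<in> C" and C: "C \<in> irr_components A X"
    using limit_set_nonempty[OF x, of s] by blast
  let ?R = "\<Union>(irr_components A X - {C})"
  have "limit_set s x \<subseteq> C"
    unfolding limit_set_def
  proof (rule orbit_limit_points_subset[OF compact_space_sub_top metrizable_space_sub_top
        continuous_map_translate[of s]])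
    show "range (\<lambda>k. translate (s * int k) x) \<subseteq> topspace (sub_top A X)"
      using x by auto
    show "translate (s * int (Suc k)) x = translate s (translate (s * int k) x)" for k
      by (simp add: algebra_simps)
    show "closedin (sub_top A X) C" by (rule closedin_irr_component[OF C])
    show "closedin (sub_top A X) ?R"
      using finite_irr_components by (intro closedin_Union) (auto intro: closedin_irr_component)
    show "disjnt C ?R" using C irr_component_unique by (fastforce simp: disjnt_iff)
    show "translate s ` C \<subseteq> C" using C irr_component_translate by blast
    show "translate s ` ?R \<subseteq> ?R" using irr_component_translate by blast
    show "limit_points (sub_top A X) (\<lambda>k. translate (s * int k) x) \<subseteq> C \<union> ?R"
      using NW unfolding limit_set_def by blast
    show "limit_points (sub_top A X) (\<lambda>k. translate (s * int k) x) \<inter> C \<noteq> {}"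
      using y unfolding limit_set_def by blast
  qed
  then show ?thesis using C by blast
qed

definition limit_component :: "int \<Rightarrow> (int \<Rightarrow> 'a) \<Rightarrow> (int \<Rightarrow> 'a) set" where
  "limit_component s x = (THE C. C \<in> irr_components A X \<and> limit_set s x \<subseteq> C)"

lemma C_omega_eq: "C_omega A X x = limit_component 1 x"
  by (simp add: C_omega_def limit_component_def omega_limit_eq)

lemma C_alpha_eq: "C_alpha A X x = limit_component (-1) x"
  by (simp add: C_alpha_def limit_component_def alpha_limit_eq)

lemma limit_component:
  assumes x: "x \<in> X" and "s \<noteq> 0"
  shows "limit_component s x \<in> irr_components A X" and "limit_set s x \<subseteq> limit_component s x"
proof -
  have "\<exists>!C. C \<in> irr_components A X \<and> limit_set s x \<subseteq> C"
    using limit_set_subset_irr_component[OF assms] limit_set_nonempty[OF x, of s]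
      irr_component_unique by blast
  from theI'[OF this]
  show "limit_component s x \<in> irr_components A X" "limit_set s x \<subseteq> limit_component s x"
    unfolding limit_component_def by blast+
qed

lemma endomorphism_image_irr_component:
  assumes \<tau>: "endomorphism A X \<tau>" and C: "C \<in> irr_components A X"
  shows "\<exists>D\<in>irr_components A X. \<tau> ` C \<subseteq> D"
proof (rule irreducible_image_subset_of_finite_cover)
  have "continuous_map (sub_top A X) (full_shift A) \<tau>"
    using endomorphism_continuous[OF \<tau>] by (simp add: continuous_map_in_subtopology)
  then show "continuous_map (sub_top A C) (full_shift A) \<tau>"
    by (rule continuous_map_from_subtopology_mono) (rule irr_component_subset[OF C])
  show "\<tau> (translate p x) = translate p (\<tau> x)" if "x \<in> C" for p x
    using endomorphism_translate[OF \<tau>] irr_component_subset[OF C] that by blast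
  show "\<tau> ` C \<subseteq> \<Union>(irr_components A X)"
    using endomorphism_NW[OF \<tau>] C Union_irr_components by blast
qed (simp_all add: C finite_irr_components irreducible_irr_component subshift_irr_component)

lemma induced_map_eq:
  assumes \<rho>: "induced_map A X \<tau> \<rho>" and C: "C \<in> irr_components A X"
    and D: "D \<in> irr_components A X" and x: "x \<in> C" "\<tau> x \<in> D"
  shows "\<rho> C = D"
proof (rule irr_component_unique)
  show "\<rho> C \<in> irr_components A X" "\<tau> x \<in> \<rho> C"
    using \<rho> C x(1) unfolding induced_map_def by auto
qed (fact D x(2))+

lemma induced_map_unique:
  assumes \<rho>: "induced_map A X \<tau> \<rho>" and \<rho>': "induced_map A X \<tau> \<rho>'"
  shows "\<rho> = \<rho>'"
proof (rule PiE_ext)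
  show "\<rho> \<in> irr_components A X \<rightarrow>\<^sub>E irr_components A X"
    "\<rho>' \<in> irr_components A X \<rightarrow>\<^sub>E irr_components A X"
    using \<rho> \<rho>' by (simp_all add: induced_map_def)
  fix C assume C: "C \<in> irr_components A X"
  then obtain x where "x \<in> C" using irr_component_nonempty by blast
  then show "\<rho> C = \<rho>' C"
    using \<rho>' C by (intro induced_map_eq[OF \<rho> C]) (auto simp: induced_map_def)
qed

lemma ex1_induced_map:
  assumes \<tau>: "endomorphism A X \<tau>"
  shows "\<exists>!\<rho>. induced_map A X \<tau> \<rho>"
proof -
  obtain f where f: "\<And>C. C \<in> irr_components A X \<Longrightarrow> f C \<in> irr_components A X \<and> \<tau> ` C \<subseteq> f C"
    using endomorphism_image_irr_component[OF \<tau>] by metis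
  have "induced_map A X \<tau> (restrict f (irr_components A X))"
    unfolding induced_map_def using f by auto
  then show ?thesis using induced_map_unique by blast
qed

lemma induced_map_rho: "endomorphism A X \<tau> \<Longrightarrow> induced_map A X \<tau> (rho A X \<tau>)"
  unfolding rho_def by (rule theI'[OF ex1_induced_map])

lemma rho_PiE: "endomorphism A X \<tau> \<Longrightarrow> rho A X \<tau> \<in> irr_components A X \<rightarrow>\<^sub>E irr_components A X"
  using induced_map_rho by (simp add: induced_map_def)

lemma rho_eqI: "endomorphism A X \<tau> \<Longrightarrow> induced_map A X \<tau> \<rho> \<Longrightarrow> rho A X \<tau> = \<rho>"
  by (rule induced_map_unique[OF induced_map_rho])

lemma rho_limit_component:
  assumes \<tau>: "endomorphism A X \<tau>" and x: "x \<in> X" and s: "s \<noteq> 0"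
  shows "rho A X \<tau> (limit_component s x) = limit_component s (\<tau> x)"
proof -
  obtain y where y: "y \<in> limit_set s x" using limit_set_nonempty[OF x] by blast
  then have "\<tau> y \<in> limit_set s (\<tau> x)" by (rule endomorphism_limit_set[OF \<tau> x])
  with y show ?thesis
    using limit_component[OF x s] limit_component[OF endomorphism_mem[OF \<tau> x] s]
    by (intro induced_map_eq[OF induced_map_rho[OF \<tau>]]) auto
qed

lemma rho_C_alpha:
  "endomorphism A X \<tau> \<Longrightarrow> x \<in> X \<Longrightarrow> rho A X \<tau> (C_alpha A X x) = C_alpha A X (\<tau> x)"
  by (simp add: C_alpha_eq rho_limit_component)

lemma rho_C_omega:
  "endomorphism A X \<tau> \<Longrightarrow> x \<in> X \<Longrightarrow> rho A X \<tau> (C_omega A X x) = C_omega A X (\<tau> x)"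
  by (simp add: C_omega_eq rho_limit_component)

lemma poset_endomorphism_rho:
  assumes \<tau>: "endomorphism A X \<tau>"
  shows "poset_endomorphism (irr_components A X) (comp_le A X) (rho A X \<tau>)"
  unfolding poset_endomorphism_def
proof
  show "monotone_on (irr_components A X) (comp_le A X) (comp_le A X) (rho A X \<tau>)"
  proof (rule monotone_onI)
    fix C D assume "comp_le A X C D"
    then obtain x where x: "x \<in> X" "C = C_alpha A X x" "D = C_omega A X x"
      unfolding comp_le_def by blast
    then have "rho A X \<tau> C = C_alpha A X (\<tau> x)" "rho A X \<tau> D = C_omega A X (\<tau> x)"
      using rho_C_alpha[OF \<tau>] rho_C_omega[OF \<tau>] by simp_all
    then show "comp_le A X (rho A X \<tau> C) (rho A X \<tau> D)"
      using endomorphism_mem[OF \<tau> x(1)] unfolding comp_le_def by auto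
  qed
qed (rule rho_PiE[OF \<tau>])

end

section \<open>Monoids of endomorphisms\<close>

lemma monoid_extensional_maps:
  assumes F: "F \<subseteq> P \<rightarrow>\<^sub>E P" "restrict id P \<in> F"
    and compose: "\<And>f g. f \<in> F \<Longrightarrow> g \<in> F \<Longrightarrow> compose P f g \<in> F"
  shows "monoid \<lparr>carrier = F, mult = compose P, one = restrict id P\<rparr>"
proof (rule monoidI, simp_all add: F(2) compose)
  fix f assume "f \<in> F"
  then have f: "f \<in> P \<rightarrow> P" "f \<in> extensional P" using F(1) by (auto simp: PiE_def)
  show "compose P (restrict id P) f = f" "compose P f (restrict id P) = f"
    unfolding id_def using f by (rule Id_compose, rule compose_Id)
  show "compose P (compose P h g) f = compose P h (compose P g f)" for g h
    using f(1) by (rule compose_assoc[symmetric])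
qed

lemma poset_endomorphism_compose:
  assumes f: "poset_endomorphism P R f" and g: "poset_endomorphism P R g"
  shows "poset_endomorphism P R (compose P f g)"
proof -
  have "g x \<in> P" if "x \<in> P" for x using g that by (auto simp: poset_endomorphism_def)
  then show ?thesis
    using f g unfolding poset_endomorphism_def monotone_on_def by (auto simp: compose_def)
qed

lemma poset_endomorphism_id: "poset_endomorphism P R (restrict id P)"
  by (auto simp: poset_endomorphism_def monotone_on_def)

lemma monoid_End_poset: "monoid (End_poset P R)"
  unfolding End_poset_def
proof (rule monoid_extensional_maps)
  show "{f. poset_endomorphism P R f} \<subseteq> P \<rightarrow>\<^sub>E P"
    unfolding poset_endomorphism_def by blast
qed (simp_all add: poset_endomorphism_compose poset_endomorphism_id)

lemma (in subshift_system) monoid_End_shift: "monoid (End_shift A X)"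
  unfolding End_shift_def
proof (rule monoid_extensional_maps)
  show "{\<tau>. endomorphism A X \<tau>} \<subseteq> X \<rightarrow>\<^sub>E X"
    unfolding endomorphism_def by blast
qed (simp_all add: endomorphism_compose endomorphism_id)

context decomposable_subshift
begin

lemma rho_compose:
  assumes \<tau>: "endomorphism A X \<tau>" and \<tau>': "endomorphism A X \<tau>'"
  shows "rho A X (compose X \<tau> \<tau>') = compose (irr_components A X) (rho A X \<tau>) (rho A X \<tau>')"
proof (rule rho_eqI[OF endomorphism_compose[OF \<tau> \<tau>']])
  have "compose X \<tau> \<tau>' ` C \<subseteq> rho A X \<tau> (rho A X \<tau>' C)" if C: "C \<in> irr_components A X" for C
  proof -
    have "rho A X \<tau>' C \<in> irr_components A X" using rho_PiE[OF \<tau>'] C by auto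
    then have "\<tau> ` rho A X \<tau>' C \<subseteq> rho A X \<tau> (rho A X \<tau>' C)" "\<tau>' ` C \<subseteq> rho A X \<tau>' C"
      using induced_map_rho[OF \<tau>] induced_map_rho[OF \<tau>'] C by (simp_all add: induced_map_def)
    then show ?thesis using irr_component_subset[OF C] by (auto simp: compose_def)
  qed
  then show "induced_map A X (compose X \<tau> \<tau>')
      (compose (irr_components A X) (rho A X \<tau>) (rho A X \<tau>'))"
    using rho_PiE[OF \<tau>] rho_PiE[OF \<tau>'] by (auto simp: induced_map_def compose_def)
qed

lemma rho_id: "rho A X (restrict id X) = restrict id (irr_components A X)"
  using irr_component_subset
  by (intro rho_eqI[OF endomorphism_id]) (auto simp: induced_map_def)

lemma monoid_morphism_rho:
  "monoid_morphism (End_shift A X) (End_poset (irr_components A X) (comp_le A X)) (rho A X)"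
  unfolding monoid_morphism_def
proof (intro conjI monoid_End_shift monoid_End_poset homI)
  show "rho A X \<one>\<^bsub>End_shift A X\<^esub> = \<one>\<^bsub>End_poset (irr_components A X) (comp_le A X)\<^esub>"
    by (simp add: End_shift_def End_poset_def rho_id)
qed (simp_all add: End_shift_def End_poset_def rho_compose poset_endomorphism_rho)

end

section \<open>Subshifts of finite type\<close>

definition block :: "nat \<Rightarrow> (int \<Rightarrow> 'a) \<Rightarrow> int \<Rightarrow> 'a list" where
  "block n x i = map (\<lambda>k. x (i + int k)) [0..<n]"

definition glue :: "(int \<Rightarrow> 'a) \<Rightarrow> int \<Rightarrow> (int \<Rightarrow> 'a) \<Rightarrow> int \<Rightarrow> (int \<Rightarrow> 'a)" where
  "glue x i y j = (\<lambda>t. if t < i then x t else y (t - i + j))"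

lemma block_eq_iff: "block n x i = block n y j \<longleftrightarrow> (\<forall>k<n. x (i + int k) = y (j + int k))"
  by (auto simp: block_def)

lemma block_translate [simp]: "block n (translate p x) i = block n x (i + p)"
  by (simp add: block_eq_iff translate_def algebra_simps)

lemma block_eq_if_agree:
  assumes "agree N x y" and "nat \<bar>i\<bar> + n \<le> N"
  shows "block n x i = block n y i"
proof -
  have "i + int k \<in> {- int N..int N}" if "k < n" for k
    using that assms(2) by auto
  then show ?thesis using assms(1) by (simp add: block_eq_iff agree_def)
qed

lemma glue_right: "i \<le> t \<Longrightarrow> glue x i y j t = y (t - i + j)"
  by (simp add: glue_def)

lemma glue_left:
  assumes "block n x i = block n y j" and "t < i + int n"
  shows "glue x i y j t = x t"
proof (cases "t < i")
  case False
  then obtain k where "t = i + int k" by (metis linorder_not_less zle_iff_zadd)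
  then show ?thesis using assms by (simp add: glue_def block_eq_iff add.commute)
qed (simp add: glue_def)

locale markov_subshift = subshift_system +
  fixes n :: nat
  assumes finite_alphabet: "finite A"
    and glue_mem: "x \<in> X \<Longrightarrow> y \<in> X \<Longrightarrow> block n x i = block n y j \<Longrightarrow> glue x i y j \<in> X"

lemma markov_subshift_of_finite_type:
  assumes "finite A" and "subshift_of_finite_type A X"
  obtains n where "markov_subshift A X n"
proof -
  obtain n S where subshift: "subshift A X" and
    X: "X = {x \<in> topspace (full_shift A). \<forall>i. map (\<lambda>k. x (i + int k)) [1..<Suc n] \<in> S}"
    using assms(2) unfolding subshift_of_finite_type_def by blast
  have word_eq_block: "map (\<lambda>k. x (i + int k)) [1..<Suc n] = block n x (i + 1)"
    for x :: "int \<Rightarrow> 'a" and i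
    by (rule nth_equalityI) (simp_all add: block_def algebra_simps del: upt_Suc)
  have mem_X: "x \<in> X \<longleftrightarrow> x \<in> topspace (full_shift A) \<and> (\<forall>i. block n x i \<in> S)" for x
    unfolding X word_eq_block by simp (metis diff_add_cancel)
  have "glue x i y j \<in> X" if x: "x \<in> X" and y: "y \<in> X" and same_block: "block n x i = block n y j"
    for x y i j
  proof -
    have "block n (glue x i y j) t \<in> S" for t
    proof (cases "t \<le> i")
      case True
      then have "block n (glue x i y j) t = block n x t"
        by (auto simp: block_eq_iff intro!: glue_left[OF same_block])
      then show ?thesis using x mem_X by simp
    next
      case False
      then have "block n (glue x i y j) t = block n y (t - i + j)"
        by (auto simp: block_eq_iff glue_right algebra_simps)
      then show ?thesis using y mem_X by simp
    qed
    moreover have "glue x i y j \<in> topspace (full_shift A)"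
      using x y mem_X by (simp add: mem_topspace_full_shift glue_def)
    ultimately show ?thesis using mem_X by blast
  qed
  then have "markov_subshift A X n" using subshift assms(1) by unfold_locales
  then show thesis by (rule that)
qed

context markov_subshift
begin

definition leads_to :: "'a list \<Rightarrow> 'a list \<Rightarrow> bool" where
  "leads_to u v \<longleftrightarrow> (\<exists>x\<in>X. \<exists>i j. i \<le> j \<and> block n x i = u \<and> block n x j = v)"

definition communicate :: "'a list \<Rightarrow> 'a list \<Rightarrow> bool" where
  "communicate u v \<longleftrightarrow> leads_to u v \<and> leads_to v u"

definition component :: "'a list \<Rightarrow> (int \<Rightarrow> 'a) set" where
  "component u = {x \<in> X. \<forall>i. communicate u (block n x i)}"

definition components :: "(int \<Rightarrow> 'a) set set" where
  "components = range component - {{}}"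

lemma leads_to_blocks: "x \<in> X \<Longrightarrow> i \<le> j \<Longrightarrow> leads_to (block n x i) (block n x j)"
  unfolding leads_to_def by blast

text \<open>The point \<open>z\<close> follows \<open>x\<close>, then the path between the two blocks, then \<open>y\<close>.\<close>

lemma leads_to_connect:
  assumes x: "x \<in> X" and y: "y \<in> X" and "leads_to (block n x i) (block n y j)"
  obtains z p where "z \<in> X" "i \<le> p" "\<And>t. t < i + int n \<Longrightarrow> z t = x t"
    "\<And>t. p \<le> t \<Longrightarrow> z t = y (t - p + j)"
proof -
  from assms(3) obtain q a b where q: "q \<in> X" "a \<le> b" "block n x i = block n q a"
    "block n q b = block n y j"
    unfolding leads_to_def by metis
  define w where "w = glue x i q a"
  define p where "p = i + (b - a)"
  have w: "w \<in> X" unfolding w_def by (rule glue_mem[OF x q(1,3)])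
  have "block n w p = block n q b"
    using q(2) by (auto simp: w_def p_def block_eq_iff glue_right algebra_simps)
  then have same_block: "block n w p = block n y j" using q(4) by simp
  have "i \<le> p" using q(2) by (simp add: p_def)
  moreover have "glue w p y j t = x t" if "t < i + int n" for t
  proof -
    have "glue w p y j t = w t" using that \<open>i \<le> p\<close> by (intro glue_left[OF same_block]) simp
    also have "\<dots> = x t" unfolding w_def using that by (rule glue_left[OF q(3)])
    finally show ?thesis .
  qed
  ultimately show thesis using that glue_mem[OF w y same_block] glue_right by blast
qed

lemma leads_to_trans:
  assumes "leads_to u v" and "leads_to v w"
  shows "leads_to u w"
proof -
  from assms(1) obtain x i j where x: "x \<in> X" "i \<le> j" "block n x i = u" "block n x j = v"
    unfolding leads_to_def by blast
  from assms(2) obtain y k where y: "y \<in> X" "block n y k = w"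
    unfolding leads_to_def by blast
  obtain z p where z: "z \<in> X" "j \<le> p" "\<And>t. t < j + int n \<Longrightarrow> z t = x t"
      "\<And>t. p \<le> t \<Longrightarrow> z t = y (t - p + k)"
    using leads_to_connect[OF x(1) y(1), of j k] x(4) y(2) assms(2) by blast
  have "block n z i = block n x i" using x(2) z(3) by (simp add: block_eq_iff)
  moreover have "block n z p = block n y k" using z(4) by (simp add: block_eq_iff add.commute)
  moreover have "i \<le> p" using x(2) z(2) by simp
  ultimately show ?thesis using leads_to_blocks[OF z(1)] x(3) y(2) by metis
qed

lemma communicate_sym: "communicate u v \<Longrightarrow> communicate v u"
  by (simp add: communicate_def)

lemma communicate_trans: "communicate u v \<Longrightarrow> communicate v w \<Longrightarrow> communicate u w"
  unfolding communicate_def by (blast intro: leads_to_trans)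

lemma communicate_between:
  assumes "z \<in> X" "i \<le> t" "t \<le> j"
    and "communicate u (block n z i)" "communicate u (block n z j)"
  shows "communicate u (block n z t)"
  using assms leads_to_blocks[of z i t] leads_to_blocks[of z t j]
  unfolding communicate_def by (blast intro: leads_to_trans)

lemma nonwandering_communicate_Suc:
  assumes x: "x \<in> NW A X"
  shows "communicate (block n x i) (block n x (i + 1))"
proof -
  define N where "N = nat \<bar>i\<bar> + n + 1"
  obtain m z where "m \<ge> 1" and z: "z \<in> X" "agree N x z" "agree N x (translate (int m) z)"
    using x unfolding mem_NW_iff_agree by blast
  have "block n x (i + 1) = block n z (i + 1)"
    by (rule block_eq_if_agree[OF z(2)]) (simp add: N_def)
  moreover have "block n x i = block n (translate (int m) z) i"
    by (rule block_eq_if_agree[OF z(3)]) (simp add: N_def)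
  ultimately have "leads_to (block n x (i + 1)) (block n x i)"
    using leads_to_blocks[OF z(1), of "i + 1" "i + int m"] \<open>m \<ge> 1\<close> by simp
  then show ?thesis
    using leads_to_blocks[of x i "i + 1"] x NW_subset by (auto simp: communicate_def)
qed

lemma nonwandering_communicate:
  assumes x: "x \<in> NW A X"
  shows "communicate (block n x i) (block n x j)"
proof (induction j rule: int_induct[where k = i])
  case base
  show ?case using leads_to_blocks[of x i i] x NW_subset by (auto simp: communicate_def)
next
  case (step1 j)
  from step1.IH nonwandering_communicate_Suc[OF x] show ?case by (rule communicate_trans)
next
  case (step2 j)
  have "communicate (block n x j) (block n x (j - 1))"
    using communicate_sym[OF nonwandering_communicate_Suc[OF x, of "j - 1"]] by simp
  with step2.IH show ?case by (rule communicate_trans)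
qed

lemma component_subset: "component u \<subseteq> X"
  by (auto simp: component_def)

lemma component_connect:
  assumes x: "x \<in> component u" and y: "y \<in> component u"
  obtains z p where "z \<in> component u" "i \<le> p" "\<And>t. t < i + int n \<Longrightarrow> z t = x t"
    "\<And>t. p \<le> t \<Longrightarrow> z t = y (t - p + j)"
proof -
  have X: "x \<in> X" "y \<in> X" and blocks_x: "\<And>t. communicate u (block n x t)"
    and blocks_y: "\<And>t. communicate u (block n y t)"
    using x y by (auto simp: component_def)
  have "leads_to (block n x i) (block n y j)"
    using communicate_trans[OF communicate_sym[OF blocks_x] blocks_y]
    by (simp add: communicate_def)
  with X obtain z p where z: "z \<in> X" "i \<le> p"
    and z_left: "\<And>t. t < i + int n \<Longrightarrow> z t = x t"
    and z_right: "\<And>t. p \<le> t \<Longrightarrow> z t = y (t - p + j)"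
    using leads_to_connect by metis
  have left: "communicate u (block n z t)" if "t \<le> i" for t
  proof -
    have "block n z t = block n x t" using that z_left by (simp add: block_eq_iff)
    then show ?thesis using blocks_x by simp
  qed
  have right: "communicate u (block n z t)" if "p \<le> t" for t
  proof -
    have "block n z t = block n y (t - p + j)"
      using that z_right by (simp add: block_eq_iff algebra_simps)
    then show ?thesis using blocks_y by simp
  qed
  have "communicate u (block n z t)" for t
    using left right communicate_between[OF z(1) _ _ left[of i] right[of p], of t] by fastforce
  then have "z \<in> component u" using z(1) by (simp add: component_def)
  then show thesis using z(2) z_left z_right by (rule that)
qed

lemma component_visits:
  assumes x: "x \<in> component u" and y: "y \<in> component u"
  shows "\<exists>m\<ge>1. \<exists>z\<in>component u. agree N y z \<and> agree N x (translate (int m) z)"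
proof -
  obtain z p where "z \<in> component u" and p: "int N + 1 \<le> p"
    and z_left: "\<And>t. t < int N + 1 + int n \<Longrightarrow> z t = y t"
    and z_right: "\<And>t. p \<le> t \<Longrightarrow> z t = x (t - p + (- int N))"
    using component_connect[OF y x] by blast
  moreover have "agree N y z" using z_left by (auto simp: agree_def)
  moreover have "agree N x (translate (int (nat (p + int N))) z)"
    using p z_right by (auto simp: agree_def translate_def)
  moreover have "nat (p + int N) \<ge> 1" using p by simp
  ultimately show ?thesis by blast
qed

lemma subshift_component: "subshift A (component u)"
proof (rule subshiftI)
  have "x \<in> component u"
    if x: "x \<in> topspace (full_shift A)" and approx: "\<And>N. \<exists>y\<in>component u. agree N x y" for x
  proof -
    have "closedin (full_shift A) X" using subshift by (simp add: subshift_def)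
    then have "x \<in> X" using x approx component_subset unfolding closedin_full_shift_iff by blast
    moreover have "communicate u (block n x i)" for i
    proof -
      obtain y where "y \<in> component u" "agree (nat \<bar>i\<bar> + n) x y" using approx by blast
      then show ?thesis using block_eq_if_agree[of _ x y i n] by (simp add: component_def)
    qed
    ultimately show ?thesis by (simp add: component_def)
  qed
  then show "closedin (full_shift A) (component u)"
    using component_subset subset_full_shift unfolding closedin_full_shift_iff by blast
  show "translate p x \<in> component u" if "x \<in> component u" for p x
    using that by (simp add: component_def)
qed

lemma irreducible_component: "component u \<noteq> {} \<Longrightarrow> irreducible_subshift A (component u)"
  by (rule irreducible_subshiftI[OF subshift_component _ component_visits])

lemma component_subset_NW: "component u \<subseteq> NW A X"
proof
  fix x assume x: "x \<in> component u"
  then show "x \<in> NW A X"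
    using component_visits[OF x x] component_subset unfolding mem_NW_iff_agree by blast
qed

lemma mem_component_block: "x \<in> NW A X \<Longrightarrow> x \<in> component (block n x i)"
  using nonwandering_communicate NW_subset[of A X] by (auto simp: component_def)

lemma component_eq_component_block:
  assumes "x \<in> component u"
  shows "component u = component (block n x i)"
  using assms unfolding component_def by (blast intro: communicate_trans communicate_sym)

lemma finite_components: "finite components"
proof (rule finite_subset)
  show "components \<subseteq> component ` {w. set w \<subseteq> A \<and> length w = n}"
  proof
    fix C assume "C \<in> components"
    then obtain u x where C: "C = component u" and x: "x \<in> component u"
      unfolding components_def by blast
    have "set (block n x 0) \<subseteq> A" "length (block n x 0) = n"
      using x component_subset subset_full_shift
      by (auto simp: block_def mem_topspace_full_shift subset_iff)
    then show "C \<in> component ` {w. set w \<subseteq> A \<and> length w = n}"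
      using C component_eq_component_block[OF x] by blast
  qed
qed (intro finite_imageI finite_lists_length_eq finite_alphabet)

lemma irreducible_decomposition_components:
  "irreducible_decomposition A (NW A X) components"
  unfolding irreducible_decomposition_def
proof (intro conjI ballI finite_components)
  show "partition_on (NW A X) components"
  proof (rule partition_onI)
    show "\<Union>components = NW A X"
      unfolding components_def using component_subset_NW mem_component_block by fast
    fix C D assume "C \<in> components" "D \<in> components" "C \<noteq> D"
    then obtain u v where "C = component u" "D = component v" "component u \<noteq> component v"
      unfolding components_def by blast
    then show "disjnt C D" using component_eq_component_block by (metis disjnt_iff)
  qed (simp add: components_def)
  show "irreducible_subshift A C" if "C \<in> components" for C
    using that irreducible_component by (auto simp: components_def)
qed

lemma decomposable_subshift: "decomposable_subshift A X"
  using finite_alphabet irreducible_decomposition_components by unfold_locales blast+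

end

theorem proposition3p14:
  fixes A :: "'a set" and X :: "(int \<Rightarrow> 'a) set"
  assumes "finite A" and "subshift_of_finite_type A X"
  shows "(\<forall>\<tau>. endomorphism A X \<tau> \<longrightarrow>
            (\<exists>!\<rho>. induced_map A X \<tau> \<rho>) \<and>
            (\<forall>x\<in>X. rho A X \<tau> (C_alpha A X x) = C_alpha A X (\<tau> x) \<and>
                    rho A X \<tau> (C_omega A X x) = C_omega A X (\<tau> x)) \<and>
            poset_endomorphism (irr_components A X) (comp_le A X) (rho A X \<tau>)) \<and>
         monoid_morphism (End_shift A X) (End_poset (irr_components A X) (comp_le A X)) (rho A X)"
proof -
  obtain n where "markov_subshift A X n"
    using markov_subshift_of_finite_type[OF assms] .
  then interpret decomposable_subshift A X by (rule markov_subshift.decomposable_subshift)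
  show ?thesis
    using ex1_induced_map rho_C_alpha rho_C_omega poset_endomorphism_rho monoid_morphism_rho
    by blast
qed

end
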